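(* Let $\mathcal{P}=\{A_1,A_2,A_3\}$. Then for every integer $n\ge 1$, $$s_n(\mathcal{P}\cup\{B_1\})=s_n(\mathcal{P}\cup\{B_2\})=s_n(\mathcal{P}\cup\{B_3\})=\tfrac43(2n+1)!!,$$ $$s_n(\mathcal{P}\cup\{B_4\})=s_n(\mathcal{P}\cup\{B_5\})=2^n(n+1)!,$$ $$s_n(\mathcal{P}\cup\{B_6\})=(n+3)(2n+1)!!-(2n+2)!!.$$
   Context: A standard piece is a $2\times 2$ matrix whose four entries are $1,2,3,4$, each occurring exactly once. For $n\ge 1$, a standard $n$-puzzle is a $2\times(n+1)$ matrix whose entries are $1,2,\dots,2n+2$, each occurring exactly once; its pieces are its $n$ submatrices formed by two consecutive columns. The reduction of a piece is the standard piece obtained by replacing its four distinct entries by $1,2,3,4$ in an order-preserving way. A set $\mathcal{P}$ of standard pieces is a support of a puzzle if the reduction of each piece of the puzzle lies in $\mathcal{P}$. $S_n(\mathcal{P})$ is the set of standard $n$-puzzles having $\mathcal{P}$ as a support, and $s_n(\mathcal{P})=|S_n(\mathcal{P})|$. The standard pieces used are $A_1=\left[\begin{smallmatrix}4&3\\1&2\end{smallmatrix}\right]$, $A_2=\left[\begin{smallmatrix}3&4\\1&2\end{smallmatrix}\right]$, $A_3=\left[\begin{smallmatrix}2&4\\1&3\end{smallmatrix}\right]$, and $B_1=\left[\begin{smallmatrix}4&2\\1&3\end{smallmatrix}\right]$, $B_2=\left[\begin{smallmatrix}3&2\\1&4\end{smallmatrix}\right]$, $B_3=\left[\begin{smallmatrix}2&3\\1&4\end{smallmatrix}\right]$,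 $B_4=\left[\begin{smallmatrix}3&1\\2&4\end{smallmatrix}\right]$, $B_5=\left[\begin{smallmatrix}4&1\\2&3\end{smallmatrix}\right]$, $B_6=\left[\begin{smallmatrix}4&1\\3&2\end{smallmatrix}\right]$. Double factorials: $(2n+1)!!=(2n+1)(2n-1)\cdots 3\cdot 1$ and $(2n)!!=(2n)(2n-2)\cdots 2$. *)

theory Defs
  imports "Jordan_Normal_Form.Matrix"
begin

definition distinct_entries :: "nat set \<Rightarrow> nat mat \<Rightarrow> bool" where
  \<comment> \<open>every element of the set occurs exactly once as an entry, and nothing else occurs\<close>
  "distinct_entries X M \<longleftrightarrow>
     bij_betw (\<lambda>ij. M $$ ij) ({0..<dim_row M} \<times> {0..<dim_col M}) X"

definition standard_piece :: "nat mat \<Rightarrow> bool" where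
  "standard_piece M \<longleftrightarrow> M \<in> carrier_mat 2 2 \<and> distinct_entries {1..4} M"

definition standard_puzzle :: "nat \<Rightarrow> nat mat \<Rightarrow> bool" where
  "standard_puzzle n M \<longleftrightarrow>
     M \<in> carrier_mat 2 (n + 1) \<and> distinct_entries {1..2 * n + 2} M"

definition pieces :: "nat mat \<Rightarrow> nat mat set" where
  "pieces M = {mat 2 2 (\<lambda>(i, k). M $$ (i, j + k)) | j. j + 1 < dim_col M}"

text \<open>
  Replacing each entry by its rank among the entries is the order-preserving relabelling
  by \<open>1, 2, \<dots>\<close> since the entries of a piece are distinct.
\<close>
definition reduction :: "nat mat \<Rightarrow> nat mat" where
  "reduction M = map_mat (\<lambda>x. card {y \<in> elements_mat M. y \<le> x}) M"

definition is_support :: "nat mat set \<Rightarrow> nat mat \<Rightarrow> bool" where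
  "is_support P M \<longleftrightarrow> (\<forall>Q \<in> pieces M. reduction Q \<in> P)"

definition supported_puzzles :: "nat \<Rightarrow> nat mat set \<Rightarrow> nat mat set" where
  "supported_puzzles n P = {M. standard_puzzle n M \<and> is_support P M}"

definition s_count :: "nat \<Rightarrow> nat mat set \<Rightarrow> nat" where
  "s_count n P = card (supported_puzzles n P)"

definition A1 :: "nat mat" where "A1 = mat_of_rows_list 2 [[4, 3], [1, 2]]"
definition A2 :: "nat mat" where "A2 = mat_of_rows_list 2 [[3, 4], [1, 2]]"
definition A3 :: "nat mat" where "A3 = mat_of_rows_list 2 [[2, 4], [1, 3]]"

definition B1 :: "nat mat" where "B1 = mat_of_rows_list 2 [[4, 2], [1, 3]]"
definition B2 :: "nat mat" where "B2 = mat_of_rows_list 2 [[3, 2], [1, 4]]"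
definition B3 :: "nat mat" where "B3 = mat_of_rows_list 2 [[2, 3], [1, 4]]"
definition B4 :: "nat mat" where "B4 = mat_of_rows_list 2 [[3, 1], [2, 4]]"
definition B5 :: "nat mat" where "B5 = mat_of_rows_list 2 [[4, 1], [2, 3]]"
definition B6 :: "nat mat" where "B6 = mat_of_rows_list 2 [[4, 1], [3, 2]]"

fun double_fact :: "nat \<Rightarrow> nat" where
  "double_fact 0 = 1"
| "double_fact (Suc 0) = 1"
| "double_fact (Suc (Suc n)) = Suc (Suc n) * double_fact n"

lemma finite_standard_puzzles: "finite {M. standard_puzzle n M}"
proof (rule finite_subset)
  let ?I = "{0..<2} \<times> {0..<n + 1}"
  show "{M. standard_puzzle n M} \<subseteq> mat 2 (n + 1) ` (?I \<rightarrow>\<^sub>E {1..2 * n + 2})"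
  proof
    fix M assume "M \<in> {M. standard_puzzle n M}"
    then have c: "M \<in> carrier_mat 2 (n + 1)"
      and b: "bij_betw (\<lambda>ij. M $$ ij) ?I {1..2 * n + 2}"
      by (auto simp: standard_puzzle_def distinct_entries_def)
    have "M = mat 2 (n + 1) (restrict (\<lambda>ij. M $$ ij) ?I)"
      using c by (intro eq_matI) auto
    moreover have "restrict (\<lambda>ij. M $$ ij) ?I \<in> ?I \<rightarrow>\<^sub>E {1..2 * n + 2}"
      using bij_betwE[OF b] by auto
    ultimately show "M \<in> mat 2 (n + 1) ` (?I \<rightarrow>\<^sub>E {1..2 * n + 2})" by blast
  qed
  show "finite (mat 2 (n + 1) ` (?I \<rightarrow>\<^sub>E {1..2 * n + 2}))"
    by (intro finite_imageI finite_PiE) auto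
qed

lemma standard_piece_rowsI:
  assumes "distinct [a, b, c, d]" and "{a, b, c, d} = {1..4}"
  shows "standard_piece (mat_of_rows_list 2 [[a, b], [c, d]])"
proof -
  have I: "{0..<2::nat} \<times> {0..<2::nat} = {(0,0), (0,1), (1,0), (1,1)}" by auto
  show ?thesis
    using assms unfolding standard_piece_def distinct_entries_def
    by (simp add: I bij_betw_def mat_of_rows_list_def numeral_2_eq_2[symmetric] insert_commute)
qed

lemma standard_pieces: "\<forall>Q \<in> {A1, A2, A3, B1, B2, B3, B4, B5, B6}. standard_piece Q"
  unfolding A1_def A2_def A3_def B1_def B2_def B3_def B4_def B5_def B6_def
  by (auto intro!: standard_piece_rowsI)

lemma standard_piece_iff: "standard_piece M \<longleftrightarrow> standard_puzzle 1 M"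
  by (simp add: standard_piece_def standard_puzzle_def numeral_2_eq_2 numeral_eq_Suc)

end

theory Submission
  imports Defs
begin

text \<open>
  With \<open>b\<^sub>j\<close>, \<open>t\<^sub>j\<close> the lower and upper entry of column \<open>j\<close>, a piece reduces to \<open>A\<^sub>1\<close>, \<open>A\<^sub>2\<close> or \<open>A\<^sub>3\<close> iff
  \<open>b\<^sub>j < t\<^sub>j\<close>, \<open>b\<^sub>j < b\<^sub>j\<^sub>+\<^sub>1\<close> and \<open>b\<^sub>j\<^sub>+\<^sub>1 < t\<^sub>j\<^sub>+\<^sub>1\<close>. Every \<open>B\<^sub>i\<close> has an increasing left and a decreasing right column,
  so it can only be the last piece. Hence the least entry of a puzzle is \<open>b\<^sub>0\<close> or \<open>t\<^sub>n\<close>. In the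
  first case \<open>t\<^sub>0\<close> is arbitrary and deleting the first column leaves an arbitrary smaller puzzle,
  which gives the factor \<open>2n + 1\<close>. The second case occurs only for \<open>B\<^sub>4\<close>, \<open>B\<^sub>5\<close>, \<open>B\<^sub>6\<close>; deleting \<open>t\<^sub>n\<close>
  leaves a configuration with an odd number of entries, counted by the same recursion. Thus
  \<open>s\<^sub>n = (2n + 1) s\<^sub>n\<^sub>-\<^sub>1 + d\<^sub>n\<close> with \<open>s\<^sub>1 = 4\<close>, where \<open>d\<^sub>n\<close> is \<open>0\<close> for \<open>B\<^sub>1\<close>, \<open>B\<^sub>2\<close>, \<open>B\<^sub>3\<close>, it is \<open>(2n)!!/2\<close> for
  \<open>B\<^sub>4\<close>, \<open>B\<^sub>5\<close> and \<open>(2n + 1)!! - (2n)!!\<close> for \<open>B\<^sub>6\<close>.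
\<close>

section \<open>Removing the least entry\<close>

text \<open>
  A puzzle is read column by column, the lower entry first. The predicate \<open>E\<close> describes the
  admissible final segments.
\<close>
fun piece_chain :: "(nat list \<Rightarrow> bool) \<Rightarrow> nat list \<Rightarrow> bool" where
  "piece_chain E (b # t # c # ws) \<longleftrightarrow> E (b # t # c # ws) \<or> b < t \<and> b < c \<and> piece_chain E (c # ws)"
| "piece_chain E ws \<longleftrightarrow> E ws"

text \<open>The entry set is arbitrary because deleting entries destroys the form
  \<open>{1..k}\<close>; the counts below depend on its size only.\<close>

definition chain_lists :: "(nat list \<Rightarrow> bool) \<Rightarrow> nat set \<Rightarrow> nat list set" where
  "chain_lists E X = {ws. distinct ws \<and> set ws = X \<and> piece_chain E ws}"

text \<open>A least entry in front satisfies \<open>b < t\<close> and \<open>b < c\<close> by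
  itself, so the second entry is unrestricted and only the rest has to be a chain.\<close>

definition min_first_chains :: "(nat list \<Rightarrow> bool) \<Rightarrow> nat set \<Rightarrow> nat list set" where
  "min_first_chains E X =
     {ws. distinct ws \<and> set ws = X \<and> (\<exists>t ws'. ws = Min X # t # ws' \<and> piece_chain E ws')}"

lemma finite_distinct_lists: "finite X \<Longrightarrow> finite {ws. distinct ws \<and> set ws = X \<and> Q ws}"
  by (rule finite_subset[OF _ finite_subset_distinct[of X]]) auto

lemma finite_chain_lists: "finite X \<Longrightarrow> finite (chain_lists E X)"
  unfolding chain_lists_def by (rule finite_distinct_lists)

lemma finite_min_first_chains: "finite X \<Longrightarrow> finite (min_first_chains E X)"
  unfolding min_first_chains_def by (rule finite_distinct_lists)

text \<open>There are \<open>card X - 1\<close> choices for the second entry, and each leaves a set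
  two smaller that carries \<open>N\<close> chains by hypothesis.\<close>

lemma card_min_first_chains:
  assumes X: "finite X" "X \<noteq> {}"
    and N: "\<And>Y. finite Y \<Longrightarrow> card Y + 2 = card X \<Longrightarrow> card (chain_lists E Y) = N"
  shows "card (min_first_chains E X) = (card X - 1) * N"
proof -
  define m where "m = Min X"
  have m: "m \<in> X" using X by (simp add: m_def)
  let ?S = "Sigma (X - {m}) (\<lambda>t. chain_lists E (X - {m, t}))"
  have "min_first_chains E X = (\<lambda>(t, ws). m # t # ws) ` ?S"
  proof (intro equalityI subsetI)
    fix ws assume "ws \<in> min_first_chains E X"
    then obtain t us where w: "distinct ws" "set ws = X" "ws = m # t # us" "piece_chain E us"
      unfolding min_first_chains_def m_def by blast
    then have "set us = X - {m, t}" "t \<in> X - {m}" "distinct us" by auto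
    then have tu: "(t, us) \<in> ?S" using w(4) by (simp add: chain_lists_def)
    show "ws \<in> (\<lambda>(t, ws). m # t # ws) ` ?S"
      by (rule image_eqI[OF _ tu]) (simp add: w(3))
  next
    fix ws assume "ws \<in> (\<lambda>(t, ws). m # t # ws) ` ?S"
    then obtain t us where w: "ws = m # t # us" "t \<in> X" "t \<noteq> m" "distinct us"
      "set us = X - {m, t}" "piece_chain E us" by (auto simp: chain_lists_def)
    then have "distinct ws" "set ws = X" using m by auto
    then show "ws \<in> min_first_chains E X"
      using w unfolding min_first_chains_def m_def by blast
  qed
  moreover have "inj_on (\<lambda>(t, ws). m # t # ws) ?S" by (auto simp: inj_on_def)
  ultimately have "card (min_first_chains E X) = card ?S" by (simp add: card_image)
  also have "\<dots> = (\<Sum>t\<in>X - {m}. card (chain_lists E (X - {m, t})))"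
    using X by (simp add: finite_chain_lists)
  also have "\<dots> = (\<Sum>t\<in>X - {m}. N)"
  proof (rule sum.cong)
    fix t assume t: "t \<in> X - {m}"
    \<comment> \<open>This gives \<open>2 \<le> card X\<close>, so removing two elements lowers the
      size by exactly two, without truncation.\<close>
    then have "card {m, t} \<le> card X" using X m by (intro card_mono) auto
    then show "card (chain_lists E (X - {m, t})) = N"
      using t X m by (intro N) (auto simp: card_Diff_subset)
  qed simp
  finally show ?thesis using X m by simp
qed

text \<open>Chains inherit this from their endings, so removing the least entry leads to only two
  cases.\<close>

definition extreme_min :: "nat list \<Rightarrow> bool" where
  "extreme_min ws \<longleftrightarrow> (\<forall>x\<in>set ws. hd ws \<le> x) \<or> (\<forall>x\<in>set ws. last ws \<le> x)"

text \<open>Each recursive step puts \<open>b\<close> below \<open>t\<close> and \<open>c\<close>.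
  If \<open>c\<close> is least in the tail, \<open>b\<close> becomes least; if the final entry is,
  the smaller of \<open>b\<close> and that entry is least overall.\<close>

lemma piece_chain_extreme_min:
  assumes "\<And>ws. E ws \<Longrightarrow> extreme_min ws" and "piece_chain E ws"
  shows "extreme_min ws"
  using assms
proof (induction E ws rule: piece_chain.induct)
  case (1 E b t c ws)
  show ?case
  proof (cases "E (b # t # c # ws)")
    case True
    then show ?thesis by (rule 1)
  next
    case False
    then have h: "b < t" "b < c" "extreme_min (c # ws)" using 1 by auto
    show ?thesis
    proof (cases "\<forall>x\<in>set (c # ws). c \<le> x")
      case True
      then show ?thesis using h by (fastforce simp: extreme_min_def)
    next
      case False
      then have l: "\<forall>x\<in>set (c # ws). last (c # ws) \<le> x"
        using h by (auto simp: extreme_min_def)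
      show ?thesis
      proof (cases "b \<le> last (c # ws)")
        case True
        then have "\<forall>x\<in>set (b # t # c # ws). b \<le> x" using l h by fastforce
        then show ?thesis by (simp add: extreme_min_def)
      next
        case False
        then have "\<forall>x\<in>set (b # t # c # ws). last (c # ws) \<le> x" using l h by auto
        then show ?thesis by (simp add: extreme_min_def)
      qed
    qed
  qed
qed simp_all

text \<open>A final minimum matters only to the ending; \<open>E'\<close> is what \<open>E\<close>
  asks of the list once that minimum is deleted.\<close>

lemma piece_chain_append_min:
  assumes "\<And>ws. ws \<noteq> [] \<Longrightarrow> \<forall>x\<in>set ws. m < x \<Longrightarrow> E (ws @ [m]) \<longleftrightarrow> E' ws"
    and "ws \<noteq> []" and "\<forall>x\<in>set ws. m < x"
  shows "piece_chain E (ws @ [m]) \<longleftrightarrow> piece_chain E' ws"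
  using assms
proof (induction E ws rule: piece_chain.induct)
  case (1 E b t c ws)
  then show ?case using "1.prems"(1)[of "b # t # c # ws"] by simp
next
  case ("2_2" E v)
  then show ?case using "2_2.prems"(1)[of "[v]"] by simp
next
  \<comment> \<open>\<open>[v, w, m]\<close> still matches the recursive equation, but
    \<open>v < m\<close> fails, so only the alternative \<open>E\<close> survives.\<close>
  case ("2_3" E v w)
  then show ?case using "2_3.prems"(1)[of "[v, w]"] by simp
qed simp

text \<open>By \<open>extr\<close> the minimum is first or last. The first case contributes the
  product, the second the chains for \<open>E'\<close> on one element fewer. \<open>long\<close>
  keeps the ending from being the whole list, so there is a genuine first step.\<close>

lemma card_chain_lists_step:
  assumes X: "finite X" "3 \<le> card X"
    and N: "\<And>Y. finite Y \<Longrightarrow> card Y + 2 = card X \<Longrightarrow> card (chain_lists E Y) = N"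
    and long: "\<And>ws. length ws = card X \<Longrightarrow> \<not> E ws"
    and extr: "\<And>ws. E ws \<Longrightarrow> extreme_min ws"
    and E': "\<And>ws m. ws \<noteq> [] \<Longrightarrow> \<forall>x\<in>set ws. m < x \<Longrightarrow> E (ws @ [m]) \<longleftrightarrow> E' ws"
  shows "card (chain_lists E X) = (card X - 1) * N + card (chain_lists E' (X - {Min X}))"
proof -
  define M where "M = Min X"
  let ?L = "(\<lambda>ws. ws @ [M]) ` chain_lists E' (X - {M})"
  have ne: "X \<noteq> {}" using X by auto
  have m: "M \<in> X" and ml: "\<And>x. x \<in> X \<Longrightarrow> M \<le> x" using X ne by (auto simp: M_def)
  have ne': "X - {M} \<noteq> {}"
  proof
    assume "X - {M} = {}"
    then have "card X \<le> card {M}" by (intro card_mono) auto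
    then show False using X by simp
  qed
  have "chain_lists E X = min_first_chains E X \<union> ?L"
  proof (intro equalityI subsetI)
    fix ws assume "ws \<in> chain_lists E X"
    then have w: "distinct ws" "set ws = X" "piece_chain E ws" by (auto simp: chain_lists_def)
    have len: "length ws = card X" using w distinct_card by fastforce
    then obtain b t c us where ws: "ws = b # t # c # us"
      using X(2) unfolding len[symmetric] numeral_3_eq_3 Suc_le_length_iff by blast
    have un: "b < t" "b < c" "piece_chain E (c # us)" using w ws long[OF len] by auto
    have "extreme_min ws" by (rule piece_chain_extreme_min[OF extr w(3)])
    then consider "hd ws = M" | "last ws = M" "hd ws \<noteq> M"
    proof -
      have "hd ws \<in> X" "last ws \<in> X" using w(2) ws by auto
      then have "M \<le> hd ws" "M \<le> last ws" using ml by auto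
      moreover have "hd ws \<le> M \<or> last ws \<le> M"
        using \<open>extreme_min ws\<close> m w(2) unfolding extreme_min_def by blast
      ultimately show ?thesis using that by fastforce
    qed
    then show "ws \<in> min_first_chains E X \<union> ?L"
    proof cases
      case 1
      then show ?thesis using w ws un by (auto simp: min_first_chains_def M_def[symmetric])
    next
      case 2
      define vs where "vs = butlast ws"
      have ws2: "ws = vs @ [M]" using 2 ws unfolding vs_def by (metis append_butlast_last_id list.distinct(1))
      have vs: "distinct vs" "set vs = X - {M}" using w(1,2) unfolding ws2 by auto
      have "\<forall>x\<in>set vs. M < x" unfolding vs(2) using ml by (auto simp: less_le)
      moreover have "vs \<noteq> []" using vs(2) ne' by (metis list.set(1))
      ultimately have "piece_chain E' vs"
        using piece_chain_append_min[of M E E' vs, OF E'] w(3) ws2 by simp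
      then show ?thesis using vs ws2 by (auto simp: chain_lists_def)
    qed
  next
    fix ws assume "ws \<in> min_first_chains E X \<union> ?L"
    then show "ws \<in> chain_lists E X"
    proof
      assume "ws \<in> min_first_chains E X"
      then obtain t us where w: "distinct ws" "set ws = X" "ws = M # t # us" "piece_chain E us"
        unfolding min_first_chains_def M_def[symmetric] by blast
      have "length ws = card X" using w distinct_card by fastforce
      then obtain c vs where us: "us = c # vs" using w(3) X by (cases us) auto
      have "t \<noteq> M" "c \<noteq> M" "t \<in> X" "c \<in> X" using w us by auto
      then have "M < t" "M < c" using ml by (simp_all add: order_neq_le_trans)
      then show ?thesis using w us by (simp add: chain_lists_def)
    next
      assume "ws \<in> ?L"
      then obtain vs where vs: "ws = vs @ [M]" "distinct vs" "set vs = X - {M}" "piece_chain E' vs"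
        by (auto simp: chain_lists_def)
      have "\<forall>x\<in>set vs. M < x" unfolding vs(3) using ml by (auto simp: less_le)
      moreover have "vs \<noteq> []" using vs(3) ne' by (metis list.set(1))
      ultimately have "piece_chain E ws"
        using piece_chain_append_min[of M E E' vs, OF E'] vs by simp
      then show ?thesis using vs m by (auto simp: chain_lists_def)
    qed
  qed
  moreover have "min_first_chains E X \<inter> ?L = {}"
  proof -
    have "last ws \<noteq> M" if ws: "ws \<in> min_first_chains E X" for ws
    proof -
      obtain t us where "distinct ws" "ws = M # t # us"
        using ws unfolding min_first_chains_def M_def[symmetric] by blast
      then show ?thesis by (metis distinct.simps(2) last_ConsR last_in_set list.distinct(1))
    qed
    moreover have "last ws = M" if "ws \<in> ?L" for ws using that by auto
    ultimately show ?thesis by blast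
  qed
  moreover have "card ?L = card (chain_lists E' (X - {M}))" by (simp add: card_image inj_on_def)
  ultimately show ?thesis
    using card_min_first_chains[OF X(1) ne N] X(1)
    unfolding M_def[symmetric]
    by (simp add: card_Un_disjoint finite_min_first_chains finite_chain_lists)
qed

section \<open>Order types and recursions\<close>

text \<open>\<open>\<sigma>\<close> lists the positions of \<open>ws\<close> by increasing entry, i.e. it is the inverse of the reduction.\<close>
definition order_type :: "nat list \<Rightarrow> nat list \<Rightarrow> bool" where
  "order_type \<sigma> ws \<longleftrightarrow> length ws = length \<sigma> \<and> sorted_wrt (<) (map ((!) ws) \<sigma>)"

text \<open>The order type forces the elements of \<open>X\<close>, taken in increasing order, into
  the positions listed by the permutation \<open>\<sigma>\<close>, which determines the
  list.\<close>

lemma card_order_type: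
  assumes \<sigma>: "distinct \<sigma>" "set \<sigma> = {..<length \<sigma>}" and X: "finite X" "card X = length \<sigma>"
  shows "card {ws. distinct ws \<and> set ws = X \<and> order_type \<sigma> ws} = 1"
proof -
  let ?n = "length \<sigma>"
  define l where "l = sorted_list_of_set X"
  have l: "length l = ?n" "set l = X" "distinct l" "sorted_wrt (<) l"
    using X by (simp_all add: l_def)
  \<comment> \<open>The inverse permutation: \<open>f k\<close> is the rank, counted from 0, of the
    entry at position \<open>k\<close>.\<close>
  define f where "f = the_inv_into {..<?n} ((!) \<sigma>)"
  have b: "bij_betw ((!) \<sigma>) {..<?n} {..<?n}" using bij_betw_nth[OF \<sigma>(1)] \<sigma>(2) by auto
  have fb: "bij_betw f {..<?n} {..<?n}"
    unfolding f_def by (rule bij_betw_the_inv_into[OF b])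
  have f: "f (\<sigma> ! i) = i" if "i < ?n" for i
    unfolding f_def using b that by (simp add: the_inv_into_f_f bij_betw_def)
  define ws where "ws = map (\<lambda>k. l ! f k) [0..<?n]"
  have ws_len: "length ws = ?n" by (simp add: ws_def)
  have "set ws = (!) l ` f ` {..<?n}" by (auto simp: ws_def)
  also have "\<dots> = set l" using fb l(1) by (simp add: bij_betw_def set_conv_nth) blast
  finally have ws_set: "set ws = X" using l by simp
  have \<sigma>lt: "\<sigma> ! i < ?n" if "i < ?n" for i using \<sigma>(2) that nth_mem by fastforce
  have "map ((!) ws) \<sigma> = l"
    by (rule nth_equalityI) (simp_all add: l ws_def \<sigma>lt f)
  then have ws_ord: "order_type \<sigma> ws" using l ws_len by (simp add: order_type_def)
  have "distinct ws" using ws_set ws_len X by (simp add: card_distinct)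
  moreover have "vs = ws" if vs: "distinct vs" "set vs = X" "order_type \<sigma> vs" for vs
  proof -
    have len: "length vs = ?n" and s: "sorted_wrt (<) (map ((!) vs) \<sigma>)"
      using vs by (simp_all add: order_type_def)
    have "set (map ((!) vs) \<sigma>) = X"
    proof -
      have "set vs = (!) vs ` {..<?n}" using len by (auto simp: set_conv_nth)
      then show ?thesis using \<sigma>(2) vs(2) by simp
    qed
    then have "set (map ((!) vs) \<sigma>) = set l" using l(2) by simp
    \<comment> \<open>A strictly increasing list is determined by its set, so reading
      \<open>vs\<close> along \<open>\<sigma>\<close> gives the sorted list.\<close>
    then have e: "map ((!) vs) \<sigma> = l" by (rule strict_sorted_equal[OF l(4) s])
    show ?thesis
    proof (rule nth_equalityI)
      fix k assume "k < length vs"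
      then have "k \<in> (!) \<sigma> ` {..<?n}" using b len by (simp add: bij_betw_def)
      then obtain i where i: "i < ?n" "k = \<sigma> ! i" by auto
      then have "vs ! k = l ! i" using arg_cong[OF e, of "\<lambda>x. x ! i"] by simp
      then show "vs ! k = ws ! k" using i f \<sigma>lt by (simp add: ws_def)
    qed (simp add: len ws_len)
  qed
  ultimately have "{ws. distinct ws \<and> set ws = X \<and> order_type \<sigma> ws} = {ws}"
    using ws_set ws_ord by blast
  then show ?thesis by simp
qed

text \<open>The head of an order type is the position of the least entry, here the first or the last
  one.\<close>

lemma order_type_extreme_min:
  assumes "set (k # \<sigma>) = {..length \<sigma>}" "k = 0 \<or> k = length \<sigma>" "order_type (k # \<sigma>) ws"
  shows "extreme_min ws"
proof -
  have len: "length ws = Suc (length \<sigma>)" and lt: "\<forall>i\<in>set \<sigma>. ws ! k < ws ! i"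
    using assms(3) by (auto simp: order_type_def)
  have "ws ! k \<le> x" if x: "x \<in> set ws" for x
  proof -
    obtain i where i: "i < length ws" "x = ws ! i" using x by (auto simp: in_set_conv_nth)
    then have "i \<in> set (k # \<sigma>)" unfolding assms(1) using len by simp
    then show ?thesis using lt i by auto
  qed
  moreover have "ws \<noteq> []" using len by auto
  ultimately show ?thesis
    using assms(2) len by (auto simp: extreme_min_def hd_conv_nth last_conv_nth)
qed

text \<open>The head \<open>length \<sigma>\<close> is the position of the appended
  \<open>m\<close>; all other indices fall into \<open>ws\<close>.\<close>

lemma order_type_append_min:
  assumes "set \<sigma> = {..<length \<sigma>}" "\<forall>x\<in>set ws. m < x"
  shows "order_type (length \<sigma> # \<sigma>) (ws @ [m]) \<longleftrightarrow> order_type \<sigma> ws"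
proof (cases "length ws = length \<sigma>")
  case True
  then have "map ((!) (ws @ [m])) \<sigma> = map ((!) ws) \<sigma>" using assms(1) by (auto simp: nth_append)
  moreover have "\<forall>i\<in>set \<sigma>. m < ws ! i" using assms True by simp
  moreover have "(ws @ [m]) ! length \<sigma> = m" using True by (metis nth_append_length)
  ultimately show ?thesis using True by (simp add: order_type_def cong: map_cong)
qed (simp add: order_type_def)

text \<open>Head 0 demands the minimum in front, while the appended \<open>m\<close> at position
  \<open>length \<sigma>\<close> is smaller than the front entry.\<close>

lemma not_order_type_append_min:
  assumes "ws \<noteq> []" "\<forall>x\<in>set ws. m < x" "length \<sigma> \<in> set \<sigma>"
  shows "\<not> order_type (0 # \<sigma>) (ws @ [m])"
proof
  assume o: "order_type (0 # \<sigma>) (ws @ [m])"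
  then have "length ws = length \<sigma>" by (simp add: order_type_def)
  moreover have "(ws @ [m]) ! 0 < (ws @ [m]) ! length \<sigma>"
    using o assms(3) by (auto simp: order_type_def)
  ultimately have "ws ! 0 < m" using assms(1,3) by (cases \<sigma>) (auto simp: nth_append)
  then show False using assms(1,2) by (metis length_greater_0_conv less_asym nth_mem)
qed

text \<open>A chain always stops at a suffix satisfying its ending. Hence the second summand of the
  recursion vanishes when no chain can end in the minimum.\<close>

lemma piece_chain_False: "\<not> piece_chain (\<lambda>_. False) ws"
proof -
  \<comment> \<open>The ending is an argument of \<open>piece_chain\<close> and of its induction
    rule, so it becomes a variable with an equation.\<close>
  have "E = (\<lambda>_. False) \<Longrightarrow> \<not> piece_chain E ws" for E
    by (induction E ws rule: piece_chain.induct) auto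
  then show ?thesis by simp
qed

lemma chain_lists_False: "chain_lists (\<lambda>_. False) X = {}"
  by (simp add: chain_lists_def piece_chain_False)

lemma piece_chain_short: "length ws \<le> 2 \<Longrightarrow> piece_chain E ws \<longleftrightarrow> E ws"
  by (cases "(E, ws)" rule: piece_chain.cases) auto

lemma chain_lists_short:
  assumes "card X \<le> 2"
  shows "chain_lists E X = {ws. distinct ws \<and> set ws = X \<and> E ws}"
proof -
  have "length ws \<le> 2" if "distinct ws" "set ws = X" for ws
    using distinct_card[OF that(1)] that(2) assms by simp
  then show ?thesis unfolding chain_lists_def using piece_chain_short by blast
qed

section \<open>Chains with a fixed ending of two or three entries\<close>

lemma double_fact_add_2: "double_fact (n + 2) = (n + 2) * double_fact n"
  by simp

text \<open>An increasing last column never ends in the minimum, so only the product term survives.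
  For n at least 1 these chains are the puzzles built from \<open>A1\<close>, \<open>A2\<close>,
  \<open>A3\<close> alone.\<close>

lemma card_up_chains:
  assumes "finite X" "card X = 2 * n + 2"
  shows "card (chain_lists (order_type [0, 1]) X) = double_fact (2 * n + 1)"
  using assms
proof (induction n arbitrary: X)
  case 0
  have "chain_lists (order_type [0, 1]) X =
      {ws. distinct ws \<and> set ws = X \<and> order_type [0, 1] ws}"
    using 0 by (intro chain_lists_short) simp
  moreover have "card \<dots> = 1" using 0 by (intro card_order_type) auto
  ultimately show ?case by simp
next
  case (Suc n)
  have "card (chain_lists (order_type [0, 1]) X) = (card X - 1) * double_fact (2 * n + 1)
      + card (chain_lists (\<lambda>_. False) (X - {Min X}))"
  proof (rule card_chain_lists_step)
    show "extreme_min ws" if "order_type [0, 1] ws" for ws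
      using that by (rule order_type_extreme_min[rotated 2]) auto
    show "order_type [0, 1] (ws @ [m]) \<longleftrightarrow> False" if "ws \<noteq> []" "\<forall>x\<in>set ws. m < x" for ws m
      using not_order_type_append_min[OF that, of "[1]"] by simp
    show "card (chain_lists (order_type [0, 1]) Y) = double_fact (2 * n + 1)"
      if "finite Y" "card Y + 2 = card X" for Y
      using that Suc.prems by (intro Suc.IH) simp_all
  qed (use Suc.prems in \<open>simp_all add: order_type_def\<close>)
  then show ?case using Suc.prems by (simp add: chain_lists_False)
qed

lemma card_odd_chains_base:
  assumes "distinct \<sigma>" "set \<sigma> = {..<3}" "length \<sigma> = 3" "finite X" "card X = 3"
  shows "card (chain_lists (order_type \<sigma>) X) = 1"
proof -
  have "piece_chain (order_type \<sigma>) ws \<longleftrightarrow> order_type \<sigma> ws" if "length ws = 3" for ws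
    using that assms(3) by (auto simp: numeral_3_eq_3 length_Suc_conv order_type_def)
  then have "chain_lists (order_type \<sigma>) X = {ws. distinct ws \<and> set ws = X \<and> order_type \<sigma> ws}"
    unfolding chain_lists_def by (intro Collect_cong) (metis assms(5) distinct_card)
  moreover have "card \<dots> = 1" using assms by (intro card_order_type) auto
  ultimately show ?thesis by simp
qed

text \<open>Deleting the least entry of a last piece \<open>B4\<close> or \<open>B5\<close> leaves
  this ending, whose own minimum comes first. The factors are 2n+2, ..., 4, so the value is half of
  (2n+2)!!.\<close>

lemma card_odd_chains:
  assumes "finite X" "card X = 2 * n + 3" and "set \<sigma> = {1, 2}" "length \<sigma> = 2"
  shows "card (chain_lists (order_type (0 # \<sigma>)) X) = 2 ^ n * fact (n + 1)"
  using assms(1,2)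
proof (induction n arbitrary: X)
  case 0
  have "distinct \<sigma>" using assms(3,4) by (simp add: card_distinct)
  moreover have "set (0 # \<sigma>) = {..<3}" unfolding list.set assms(3) by auto
  ultimately have "card (chain_lists (order_type (0 # \<sigma>)) X) = 1"
    using 0 assms(3,4) by (intro card_odd_chains_base) (simp_all only: distinct.simps, auto)
  then show ?case by simp
next
  case (Suc n)
  have "card (chain_lists (order_type (0 # \<sigma>)) X) = (card X - 1) * (2 ^ n * fact (n + 1))
      + card (chain_lists (\<lambda>_. False) (X - {Min X}))"
  proof (rule card_chain_lists_step)
    show "extreme_min ws" if "order_type (0 # \<sigma>) ws" for ws
    proof (rule order_type_extreme_min[OF _ _ that])
      show "set (0 # \<sigma>) = {..length \<sigma>}" unfolding list.set assms(3,4) by auto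
    qed simp
    show "order_type (0 # \<sigma>) (ws @ [m]) \<longleftrightarrow> False" if "ws \<noteq> []" "\<forall>x\<in>set ws. m < x" for ws m
      using not_order_type_append_min[OF that, of \<sigma>] unfolding assms(3,4) by simp
    show "card (chain_lists (order_type (0 # \<sigma>)) Y) = 2 ^ n * fact (n + 1)"
      if "finite Y" "card Y + 2 = card X" for Y
      using that Suc.prems by (intro Suc.IH) simp_all
  qed (use Suc.prems assms(4) in \<open>simp_all add: order_type_def\<close>)
  then show ?case using Suc.prems by (simp add: chain_lists_False algebra_simps)
qed

text \<open>The ending left by \<open>B6\<close> has its own minimum last. Deleting that too leaves
  a chain with increasing last column, so the counts satisfy a_(n+1) = (2n+4) a_n + (2n+3)!!. The
  additive form avoids truncated subtraction.\<close>

lemma card_odd_chains_last_small: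
  assumes "finite X" "card X = 2 * n + 3"
  shows "card (chain_lists (order_type [2, 0, 1]) X) + double_fact (2 * n + 2)
    = double_fact (2 * n + 3)"
  using assms
proof (induction n arbitrary: X)
  case 0
  then have "card (chain_lists (order_type [2, 0, 1]) X) = 1"
    by (intro card_odd_chains_base) auto
  then show ?case by (simp add: numeral_3_eq_3)
next
  case (Suc n)
  let ?N = "double_fact (2 * n + 3) - double_fact (2 * n + 2)"
  have "card (chain_lists (order_type [2, 0, 1]) X) = (card X - 1) * ?N
      + card (chain_lists (order_type [0, 1]) (X - {Min X}))"
  proof (rule card_chain_lists_step)
    show "extreme_min ws" if "order_type [2, 0, 1] ws" for ws
      using that by (rule order_type_extreme_min[rotated 2]) auto
    show "order_type [2, 0, 1] (ws @ [m]) \<longleftrightarrow> order_type [0, 1] ws"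
      if "ws \<noteq> []" "\<forall>x\<in>set ws. m < x" for ws m
      using order_type_append_min[of "[0, 1]" ws m] that by (simp add: numeral_2_eq_2 lessThan_Suc insert_commute)
    show "card (chain_lists (order_type [2, 0, 1]) Y) = ?N"
      if "finite Y" "card Y + 2 = card X" for Y
      using Suc.IH[of Y] that Suc.prems by simp
  qed (use Suc.prems in \<open>simp_all add: order_type_def\<close>)
  also have "card (chain_lists (order_type [0, 1]) (X - {Min X})) = double_fact (2 * (n + 1) + 1)"
  proof (rule card_up_chains)
    have "Min X \<in> X" using Suc.prems by (intro Min_in) auto
    then show "card (X - {Min X}) = 2 * (n + 1) + 2" using Suc.prems by simp
  qed (use Suc.prems in simp)
  finally have step: "card (chain_lists (order_type [2, 0, 1]) X) = (card X - 1) * ?N + double_fact (2 * (n + 1) + 1)" .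
  have e: "card (chain_lists (order_type [2, 0, 1]) X) = (2 * n + 4) * ?N + double_fact (2 * n + 3)"
  proof -
    have "card X - 1 = 2 * n + 4" "2 * (n + 1) + 1 = 2 * n + 3" using Suc.prems by simp_all
    with step show ?thesis by (simp only:)
  qed
  \<comment> \<open>A sample set of the right size turns the induction hypothesis into an inequality
    of double factorials, so the subtraction in \<open>?N\<close> is exact.\<close>
  obtain Z :: "nat set" where "finite Z" "card Z = 2 * n + 3"
    using card_lessThan finite_lessThan by blast
  then have "double_fact (2 * n + 2) \<le> double_fact (2 * n + 3)" using Suc.IH[of Z] by linarith
  then obtain d where d: "double_fact (2 * n + 3) = double_fact (2 * n + 2) + d" using le_Suc_ex by blast
  have "2 * Suc n + 2 = 2 * n + 2 + 2" "2 * Suc n + 3 = 2 * n + 3 + 2"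
    "2 * n + 4 = 2 * n + 2 + 2" "2 * n + 5 = 2 * n + 3 + 2" by simp_all
  then have df: "double_fact (2 * Suc n + 2) = (2 * n + 4) * double_fact (2 * n + 2)"
    "double_fact (2 * Suc n + 3) = (2 * n + 5) * double_fact (2 * n + 3)"
    by (simp_all only: double_fact_add_2)
  \<comment> \<open>Here \<open>x\<close> is (2n+2)!! and \<open>x + d\<close> is (2n+3)!!.\<close>
  have "(2 * n + 4) * (x + d - x) + (x + d) + (2 * n + 4) * x = (2 * n + 5) * (x + d)" for x
    by (simp add: algebra_simps)
  then show ?case unfolding e df d .
qed

section \<open>Chains that may end in one exceptional piece\<close>

text \<open>Lengths separate the alternatives: \<open>[0, 1]\<close> fits the last column only, a
  \<open>\<sigma>\<close> of length 4 the last two columns, where the exceptional piece replaces the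
  final recursive step.\<close>

definition last_piece :: "nat list \<Rightarrow> nat list \<Rightarrow> bool" where
  "last_piece \<sigma> ws \<longleftrightarrow> order_type [0, 1] ws \<or> order_type \<sigma> ws"

text \<open>One chain has order type \<open>\<sigma>\<close>, and three start with the minimum, one
  for each second entry. \<open>desc\<close> keeps the two kinds apart, because the latter end in an
  increasing column.\<close>

lemma card_last_piece_base:
  assumes \<sigma>: "distinct \<sigma>" "set \<sigma> = {..<4}" "length \<sigma> = 4"
    and desc: "\<And>ws. order_type \<sigma> ws \<Longrightarrow> ws ! 3 < ws ! 2"
    and X: "finite X" "card X = 4"
  shows "card (chain_lists (last_piece \<sigma>) X) = 4"
proof -
  let ?E = "last_piece \<sigma>"
  let ?D = "{ws. distinct ws \<and> set ws = X \<and> order_type \<sigma> ws}"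
  define m where "m = Min X"
  have "X \<noteq> {}" using X by auto
  then have m: "m \<in> X" "\<And>x. x \<in> X \<Longrightarrow> m \<le> x" using X by (auto simp: m_def)
  have four: "\<exists>b t c u. ws = [b, t, c, u]" if "distinct ws" "set ws = X" for ws
  proof -
    have "length ws = 4" using that X distinct_card by fastforce
    then show ?thesis by (auto simp: length_Suc_conv numeral_eq_Suc)
  qed
  have chain4: "piece_chain ?E [b, t, c, u] \<longleftrightarrow> order_type \<sigma> [b, t, c, u] \<or> b < t \<and> b < c \<and> c < u"
    for b t c u
    using \<sigma>(3) by (auto simp: last_piece_def order_type_def)
  have chain2: "piece_chain ?E [c, u] \<longleftrightarrow> c < u" for c u
    using \<sigma>(3) by (auto simp: last_piece_def order_type_def)
  have "chain_lists ?E X = ?D \<union> min_first_chains ?E X"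
  proof (intro equalityI subsetI)
    fix ws assume "ws \<in> chain_lists ?E X"
    then have w: "distinct ws" "set ws = X" "piece_chain ?E ws" by (auto simp: chain_lists_def)
    obtain b t c u where ws: "ws = [b, t, c, u]" using four w by blast
    show "ws \<in> ?D \<union> min_first_chains ?E X"
    proof (cases "order_type \<sigma> ws")
      case True
      then show ?thesis using w by simp
    next
      case False
      then have o: "b < t" "b < c" "c < u" using w(3) chain4 unfolding ws by auto
      have "m \<in> {b, t, c, u}" "m \<le> b" using m w(2) unfolding ws by auto
      then have "b = m" using o by auto
      then have "ws = Min X # t # [c, u]" "piece_chain ?E [c, u]"
        using ws o chain2 by (simp_all add: m_def)
      then show ?thesis using w unfolding min_first_chains_def by blast
    qed
  next
    fix ws assume ws: "ws \<in> ?D \<union> min_first_chains ?E X"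
    then have w: "distinct ws" "set ws = X" by (auto simp: min_first_chains_def)
    obtain b t c u where bt: "ws = [b, t, c, u]" using four w by blast
    have "piece_chain ?E ws"
    proof (cases "order_type \<sigma> ws")
      case True
      then show ?thesis unfolding bt chain4 by simp
    next
      case False
      then have "ws \<in> min_first_chains ?E X" using ws by blast
      then obtain t' ws' where "ws = m # t' # ws'" "piece_chain ?E ws'"
        unfolding min_first_chains_def m_def by blast
      then have "b = m" "c < u" using chain2[of c u] unfolding bt by auto
      moreover have "t \<in> X" "c \<in> X" "t \<noteq> b" "c \<noteq> b" using w unfolding bt by auto
      ultimately show ?thesis using m(2) unfolding bt chain4 by (auto simp: less_le)
    qed
    then show "ws \<in> chain_lists ?E X" using w by (simp add: chain_lists_def)
  qed
  moreover have "?D \<inter> min_first_chains ?E X = {}"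
  proof -
    have False if o: "order_type \<sigma> ws" and ws: "ws \<in> min_first_chains ?E X" for ws
    proof -
      have w: "distinct ws" "set ws = X" using ws by (auto simp: min_first_chains_def)
      obtain b t c u where bt: "ws = [b, t, c, u]" using four w by blast
      obtain t' ws' where "ws = m # t' # ws'" "piece_chain ?E ws'"
        using ws unfolding min_first_chains_def m_def by blast
      then have "c < u" using chain2[of c u] unfolding bt by auto
      then show False using desc[OF o] unfolding bt by (simp add: numeral_eq_Suc)
    qed
    then show ?thesis by blast
  qed
  moreover have "card ?D = 1" using \<sigma> X by (intro card_order_type) simp_all
  moreover have "card (min_first_chains ?E X) = (card X - 1) * 1"
  proof (rule card_min_first_chains[OF X(1) \<open>X \<noteq> {}\<close>])
    fix Y :: "nat set" assume Y: "finite Y" "card Y + 2 = card X"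
    have "order_type \<sigma> ws \<Longrightarrow> length ws = 4" for ws using \<sigma>(3) by (simp add: order_type_def)
    then have "\<not> order_type \<sigma> ws" if "distinct ws" "set ws = Y" for ws
      using distinct_card[OF that(1)] that(2) Y(2) X(2) by fastforce
    then have "chain_lists ?E Y = {ws. distinct ws \<and> set ws = Y \<and> order_type [0, 1] ws}"
      using Y X(2) by (subst chain_lists_short) (auto simp: last_piece_def)
    moreover have "card \<dots> = 1" using Y X by (intro card_order_type) auto
    ultimately show "card (chain_lists ?E Y) = 1" by simp
  qed
  ultimately show ?thesis using X
    by (simp add: card_Un_disjoint finite_min_first_chains finite_distinct_lists)
qed

text \<open>The head \<open>k\<close> locates the least entry of the exceptional piece. For
  \<open>k = 0\<close> it is at the lower left and no chain ends in the minimum; for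
  \<open>k = 3\<close> it is at the upper right, and deleting it leaves the three-entry ending
  \<open>\<sigma>\<close>.\<close>

lemma card_last_piece_step:
  assumes X: "finite X" "card X = 2 * n + 6"
    and \<sigma>: "set (k # \<sigma>) = {..<4}" "length \<sigma> = 3" "k = 0 \<or> k = 3"
    and N: "\<And>Y. finite Y \<Longrightarrow> card Y = 2 * n + 4 \<Longrightarrow> card (chain_lists (last_piece (k # \<sigma>)) Y) = N"
  shows "card (chain_lists (last_piece (k # \<sigma>)) X)
    = (2 * n + 5) * N + (if k = 0 then 0 else card (chain_lists (order_type \<sigma>) (X - {Min X})))"
proof -
  \<comment> \<open>One ending serves both cases: it is identically false for
    \<open>k = 0\<close>.\<close>
  let ?E' = "\<lambda>ws. k \<noteq> 0 \<and> order_type \<sigma> ws"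
  have "distinct (k # \<sigma>)" using \<sigma> by (simp add: card_distinct del: distinct.simps)
  have \<sigma>3: "set \<sigma> = {..<3}" if "k = 3"
  proof -
    have "insert 3 (set \<sigma>) = {..<4}" "3 \<notin> set \<sigma>"
      using \<sigma>(1) that \<open>distinct (k # \<sigma>)\<close> by simp_all
    then have "set \<sigma> = {..<4} - {3}" by (metis Diff_insert_absorb)
    also have "\<dots> = {..<3}" by auto
    finally show ?thesis .
  qed
  have \<sigma>0: "3 \<in> set \<sigma>" if "k = 0"
  proof -
    have "3 \<in> set (k # \<sigma>)" unfolding \<sigma>(1) by simp
    then show ?thesis using that by simp
  qed
  have "card (chain_lists (last_piece (k # \<sigma>)) X) = (card X - 1) * N
      + card (chain_lists ?E' (X - {Min X}))"
  proof (rule card_chain_lists_step)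
    show "extreme_min ws" if "last_piece (k # \<sigma>) ws" for ws
      using that unfolding last_piece_def
    proof
      assume "order_type [0, 1] ws"
      then show ?thesis by (rule order_type_extreme_min[rotated 2]) auto
    next
      assume "order_type (k # \<sigma>) ws"
      moreover have "set (k # \<sigma>) = {..length \<sigma>}" unfolding \<sigma> by auto
      ultimately show ?thesis using \<sigma> by (intro order_type_extreme_min) simp_all
    qed
    show "last_piece (k # \<sigma>) (ws @ [m]) \<longleftrightarrow> ?E' ws" if ws: "ws \<noteq> []" "\<forall>x\<in>set ws. m < x" for ws m
    proof -
      have "\<not> order_type [0, 1] (ws @ [m])"
        using not_order_type_append_min[OF ws, of "[1]"] by simp
      moreover have "order_type (k # \<sigma>) (ws @ [m]) \<longleftrightarrow> ?E' ws"
      proof (cases "k = 0")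
        case True
        then show ?thesis using not_order_type_append_min[OF ws, of \<sigma>] \<sigma>0 \<sigma>(2) by simp
      next
        case False
        then have "k = 3" using \<sigma>(3) by simp
        then show ?thesis using order_type_append_min[of \<sigma> ws m] ws(2) \<sigma>3 \<sigma>(2) by simp
      qed
      ultimately show ?thesis by (simp add: last_piece_def)
    qed
    show "card (chain_lists (last_piece (k # \<sigma>)) Y) = N" if "finite Y" "card Y + 2 = card X" for Y
      using that X by (intro N) simp_all
    show "\<not> last_piece (k # \<sigma>) ws" if "length ws = card X" for ws
      using that X \<sigma>(2) by (simp add: last_piece_def order_type_def)
  qed (use X in simp_all)
  then show ?thesis using X by (cases "k = 0") (simp_all add: chain_lists_False)
qed

text \<open>Covers \<open>B1\<close>, \<open>B2\<close>, \<open>B3\<close>. The recursion is that of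
  the odd double factorials, but starts with 4 in place of 3!! = 3. Multiplying by 3 stays within
  the naturals.\<close>

lemma card_last_piece_min_first:
  assumes "finite X" "card X = 2 * n + 4" "set \<sigma> = {1, 2, 3}" "length \<sigma> = 3"
    and "\<And>ws. order_type (0 # \<sigma>) ws \<Longrightarrow> ws ! 3 < ws ! 2"
  shows "3 * card (chain_lists (last_piece (0 # \<sigma>)) X) = 4 * double_fact (2 * n + 3)"
  using assms(1,2)
proof (induction n arbitrary: X)
  case 0
  have s: "set (0 # \<sigma>) = {..<4}" unfolding list.set assms(3) by auto
  then have "distinct (0 # \<sigma>)" using assms(4) by (simp add: card_distinct del: distinct.simps list.set)
  then have "card (chain_lists (last_piece (0 # \<sigma>)) X) = 4"
    using 0 s assms(4,5) by (intro card_last_piece_base) simp_all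
  then show ?case by (simp add: numeral_3_eq_3)
next
  case (Suc n)
  \<comment> \<open>The division is exact by the induction hypothesis, instantiated below with the
    sample set \<open>{..<2 * n + 4}\<close>.\<close>
  let ?N = "4 * double_fact (2 * n + 3) div 3"
  have "card (chain_lists (last_piece (0 # \<sigma>)) X) = (2 * n + 5) * ?N + (if (0::nat) = 0 then 0
      else card (chain_lists (order_type \<sigma>) (X - {Min X})))"
  proof (rule card_last_piece_step)
    show "set (0 # \<sigma>) = {..<4}" unfolding list.set assms(3) by auto
    show "card (chain_lists (last_piece (0 # \<sigma>)) Y) = ?N"
      if "finite Y" "card Y = 2 * n + 4" for Y
      using Suc.IH[OF that] by linarith
  qed (use Suc.prems assms(4) in simp_all)
  moreover have "3 * ?N = 4 * double_fact (2 * n + 3)"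
    using Suc.IH[of "{..<2 * n + 4}"] by (metis card_lessThan dvd_mult_div_cancel dvd_triv_left finite_lessThan)
  moreover have "2 * Suc n + 3 = 2 * n + 3 + 2" "2 * n + 5 = 2 * n + 3 + 2" by simp_all
  moreover have "3 * (k * N) = 4 * (k * d)" if "3 * N = 4 * d" for k N d :: nat
    using that by (metis mult.left_commute)
  ultimately show ?case by (simp only: double_fact_add_2 if_True simp_thms add_0_right)
qed

text \<open>Covers \<open>B4\<close>, \<open>B5\<close>. The odd chains on 2n+5 entries are as many
  as the even chains on 2n+4 entries, so the factor 2n+5 grows to 2n+6 = 2(n+3).\<close>

lemma card_last_piece_min_last:
  assumes "finite X" "card X = 2 * n + 4" "set \<sigma> = {1, 2}" "length \<sigma> = 2"
    and "\<And>ws. order_type (3 # 0 # \<sigma>) ws \<Longrightarrow> ws ! 3 < ws ! 2"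
  shows "card (chain_lists (last_piece (3 # 0 # \<sigma>)) X) = 2 ^ (n + 1) * fact (n + 2)"
  using assms(1,2)
proof (induction n arbitrary: X)
  case 0
  have s: "set (3 # 0 # \<sigma>) = {..<4}" unfolding list.set assms(3) by auto
  then have "distinct (3 # 0 # \<sigma>)"
    using assms(4) by (simp add: card_distinct del: distinct.simps list.set)
  then have "card (chain_lists (last_piece (3 # 0 # \<sigma>)) X) = 4"
    using 0 s assms(4,5) by (intro card_last_piece_base) simp_all
  then show ?case by (simp add: numeral_2_eq_2)
next
  case (Suc n)
  have "card (chain_lists (last_piece (3 # 0 # \<sigma>)) X) = (2 * n + 5) * (2 ^ (n + 1) * fact (n + 2))
      + (if (3::nat) = 0 then 0 else card (chain_lists (order_type (0 # \<sigma>)) (X - {Min X})))"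
  proof (rule card_last_piece_step)
    show "set (3 # 0 # \<sigma>) = {..<4}" unfolding list.set assms(3) by auto
    show "card (chain_lists (last_piece (3 # 0 # \<sigma>)) Y) = 2 ^ (n + 1) * fact (n + 2)"
      if "finite Y" "card Y = 2 * n + 4" for Y
      using that by (rule Suc.IH)
  qed (use Suc.prems assms(4) in simp_all)
  moreover have "card (chain_lists (order_type (0 # \<sigma>)) (X - {Min X})) = 2 ^ (n + 1) * fact (n + 1 + 1)"
  proof (rule card_odd_chains)
    have "Min X \<in> X" using Suc.prems by (intro Min_in) auto
    then show "card (X - {Min X}) = 2 * (n + 1) + 3" using Suc.prems by simp
  qed (use Suc.prems assms(3,4) in simp_all)
  moreover have "(fact (Suc n + 2) :: nat) = (n + 3) * fact (n + 2)"
  proof -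
    have "Suc n + 2 = Suc (n + 2)" "n + 3 = Suc (n + 2)" by simp_all
    then show ?thesis by (simp only: fact_Suc of_nat_id)
  qed
  moreover have "n + 1 + 1 = n + 2" "(2::nat) ^ (Suc n + 1) = 2 * 2 ^ (n + 1)" by simp_all
  moreover have "(2 * n + 5) * (p * q) + p * q = 2 * p * ((n + 3) * q)" for p q :: nat
    by (simp add: algebra_simps)
  ultimately show ?case by (simp only: rel_simps if_False)
qed

text \<open>Covers \<open>B6\<close>. The recursion is c_(n+1) = (2n+5) c_n + (2n+5)!! - (2n+4)!!,
  again with subtraction moved to the other side.\<close>

lemma card_last_piece_both_last:
  assumes "finite X" "card X = 2 * n + 4"
  shows "card (chain_lists (last_piece [3, 2, 0, 1]) X) + double_fact (2 * n + 4)
    = (n + 4) * double_fact (2 * n + 3)"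
  using assms
proof (induction n arbitrary: X)
  case 0
  have "set [3, 2, 0, 1::nat] = {..<4}" by auto
  then have "card (chain_lists (last_piece [3, 2, 0, 1]) X) = 4"
    using 0 by (intro card_last_piece_base) (simp_all add: order_type_def)
  then show ?case by (simp add: numeral_eq_Suc)
next
  case (Suc n)
  let ?N = "(n + 4) * double_fact (2 * n + 3) - double_fact (2 * n + 4)"
  have "card (chain_lists (last_piece [3, 2, 0, 1]) X) = (2 * n + 5) * ?N
      + (if (3::nat) = 0 then 0 else card (chain_lists (order_type [2, 0, 1]) (X - {Min X})))"
  proof (rule card_last_piece_step)
    show "set [3, 2, 0, 1::nat] = {..<4}" by auto
    show "card (chain_lists (last_piece [3, 2, 0, 1]) Y) = ?N"
      if "finite Y" "card Y = 2 * n + 4" for Y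
      using Suc.IH[OF that] by linarith
  qed (use Suc.prems in simp_all)
  then have c: "card (chain_lists (last_piece [3, 2, 0, 1]) X) = (2 * n + 5) * ?N
      + card (chain_lists (order_type [2, 0, 1]) (X - {Min X}))" by simp
  have o: "card (chain_lists (order_type [2, 0, 1]) (X - {Min X})) + double_fact (2 * (n + 1) + 2)
      = double_fact (2 * (n + 1) + 3)"
  proof (rule card_odd_chains_last_small)
    have "Min X \<in> X" using Suc.prems by (intro Min_in) auto
    then show "card (X - {Min X}) = 2 * (n + 1) + 3" using Suc.prems by simp
  qed (use Suc.prems in simp)
  have N: "?N + double_fact (2 * n + 4) = (n + 4) * double_fact (2 * n + 3)"
    using Suc.IH[of "{..<2 * n + 4}"] by simp
  \<comment> \<open>\<open>d\<close> and \<open>e\<close> stand for (2n+3)!! and (2n+4)!!. Splitting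
    2n+6 as (2n+5) + 1 distributes the multiples of \<open>e\<close> over the two
    hypotheses.\<close>
  have arith: "(2 * n + 5) * N + o' + (2 * n + 4 + 2) * e = (Suc n + 4) * ((2 * n + 3 + 2) * d)"
    if "o' + e = (2 * n + 3 + 2) * d" "N + e = (n + 4) * d" for N o' d e :: nat
  proof -
    have "(2 * n + 5) * N + o' + (2 * n + 4 + 2) * e = (2 * n + 5) * (N + e) + (o' + e)"
      by (simp add: algebra_simps)
    then show ?thesis unfolding that by (simp add: algebra_simps)
  qed
  have idx: "2 * (n + 1) + 2 = 2 * n + 4" "2 * (n + 1) + 3 = 2 * n + 3 + 2"
    "2 * Suc n + 4 = 2 * n + 4 + 2" "2 * Suc n + 3 = 2 * n + 3 + 2" by simp_all
  have e3: "double_fact (2 * n + 3 + 2) = (2 * n + 3 + 2) * double_fact (2 * n + 3)"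
    and e4: "double_fact (2 * n + 4 + 2) = (2 * n + 4 + 2) * double_fact (2 * n + 4)"
    by (rule double_fact_add_2)+
  show ?case unfolding c idx(3,4) e3 e4 using arith[OF o[unfolded idx(1,2) e3] N] .
qed

section \<open>From matrices to lists\<close>

lemma mat_of_rows_list_eq_iff:
  "mat_of_rows_list 2 [[a, b], [c, d]] = mat_of_rows_list 2 [[a', b'], [c', d']]
    \<longleftrightarrow> a = a' \<and> b = b' \<and> c = c' \<and> d = (d' :: 'a)"
proof
  assume e: "mat_of_rows_list 2 [[a, b], [c, d]] = mat_of_rows_list 2 [[a', b'], [c', d']]"
  have "mat_of_rows_list 2 [[a, b], [c, d]] $$ ij = mat_of_rows_list 2 [[a', b'], [c', d']] $$ ij" for ij
    using e by simp
  from this[of "(0, 0)"] this[of "(0, 1)"] this[of "(1, 0)"] this[of "(1, 1)"]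
  show "a = a' \<and> b = b' \<and> c = c' \<and> d = d'" by (simp add: mat_of_rows_list_def)
qed simp

text \<open>Lengths of filtered four-element lists can be evaluated by simplification; distinctness
  makes them agree with the cardinalities in \<open>reduction\<close>.\<close>

lemma reduction_rows:
  assumes "distinct [t, u, b, c]"
  defines "r \<equiv> \<lambda>x. length (filter (\<lambda>y. y \<le> x) [t, u, b, c])"
  shows "reduction (mat_of_rows_list 2 [[t, u], [b, c]]) = mat_of_rows_list 2 [[r t, r u], [r b, r c]]"
proof -
  let ?M = "mat_of_rows_list 2 [[t, u], [b, c]]"
  have I: "{..<2::nat} = {0, 1}" by auto
  have el: "elements_mat ?M = set [t, u, b, c]"
    by (auto simp: elements_mat_def mat_of_rows_list_def I numeral_2_eq_2 less_Suc_eq)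
  have r: "card {y \<in> elements_mat ?M. y \<le> x} = r x" for x
    unfolding el r_def using distinct_card[OF distinct_filter[OF assms(1)], of "\<lambda>y. y \<le> x"]
    by (simp only: set_filter)
  show ?thesis unfolding reduction_def r
    by (intro eq_matI) (auto simp: mat_of_rows_list_def numeral_2_eq_2 less_Suc_eq)
qed

text \<open>The inequalities make \<open>b\<close> least and put \<open>c\<close> below
  \<open>u\<close>. Only the place of \<open>t\<close> stays free: above \<open>u\<close> for
  \<open>A1\<close>, between for \<open>A2\<close>, below \<open>c\<close> for
  \<open>A3\<close>.\<close>

lemma reduction_in_P_iff:
  assumes "distinct [t, u, b, c]"
  shows "reduction (mat_of_rows_list 2 [[t, u], [b, c]]) \<in> {A1, A2, A3} \<longleftrightarrow> b < t \<and> b < c \<and> c < u"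
  using assms unfolding reduction_rows[OF assms] A1_def A2_def A3_def
  by (simp add: mat_of_rows_list_eq_iff; linarith)

text \<open>Positions 0, 1, 2, 3 are lower left, upper left, lower right, upper right; each list
  names the places of 1, 2, 3, 4 in the matrix.\<close>

lemma reduction_eq_iff_order_type:
  assumes "distinct [t, u, b, c]"
  defines "Q \<equiv> reduction (mat_of_rows_list 2 [[t, u], [b, c]])"
  shows "Q = B1 \<longleftrightarrow> order_type [0, 3, 2, 1] [b, t, c, u]"
    and "Q = B2 \<longleftrightarrow> order_type [0, 3, 1, 2] [b, t, c, u]"
    and "Q = B3 \<longleftrightarrow> order_type [0, 1, 3, 2] [b, t, c, u]"
    and "Q = B4 \<longleftrightarrow> order_type [3, 0, 1, 2] [b, t, c, u]"
    and "Q = B5 \<longleftrightarrow> order_type [3, 0, 2, 1] [b, t, c, u]"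
    and "Q = B6 \<longleftrightarrow> order_type [3, 2, 0, 1] [b, t, c, u]"
  using assms(1) unfolding Q_def reduction_rows[OF assms(1)]
    B1_def B2_def B3_def B4_def B5_def B6_def order_type_def mat_of_rows_list_eq_iff
  by (simp; linarith)+

text \<open>Every admissible piece has an increasing left column, while \<open>\<sigma>\<close>
  makes the right column decrease. Hence a piece of type \<open>\<sigma>\<close> has no successor,
  and testing all pieces agrees with the recursion.\<close>

lemma piece_chain_last_piece_iff:
  assumes "length \<sigma> = 4"
    and \<sigma>: "\<And>b t c u. order_type \<sigma> [b, t, c, u] \<Longrightarrow> b < t \<and> u < c"
    and "length ws = 2 * n + 4"
  shows "piece_chain (last_piece \<sigma>) ws \<longleftrightarrow>
    (\<forall>j<Suc n. ws ! (2*j) < ws ! (2*j+1) \<and> ws ! (2*j) < ws ! (2*j+2) \<and> ws ! (2*j+2) < ws ! (2*j+3)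
      \<or> order_type \<sigma> [ws ! (2*j), ws ! (2*j+1), ws ! (2*j+2), ws ! (2*j+3)])"
    (is "_ \<longleftrightarrow> (\<forall>j<Suc n. ?R ws j)")
  using assms(3)
proof (induction n arbitrary: ws)
  case 0
  then obtain b t c u where "ws = [b, t, c, u]" by (auto simp: length_Suc_conv numeral_eq_Suc)
  then show ?case using assms(1) by (auto simp: last_piece_def order_type_def numeral_eq_Suc)
next
  case (Suc n)
  from Suc.prems obtain b t c u vs where ws: "ws = b # t # c # u # vs" and vs: "length vs = 2 * n + 2"
    by (auto simp: length_Suc_conv numeral_eq_Suc)
  let ?tl = "c # u # vs"
  have IH: "piece_chain (last_piece \<sigma>) ?tl \<longleftrightarrow> (\<forall>j<Suc n. ?R ?tl j)"
    using vs by (intro Suc.IH) simp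
  have shift: "?R ws (Suc j) \<longleftrightarrow> ?R ?tl j" for j by (simp add: ws numeral_eq_Suc)
  have "\<not> last_piece \<sigma> ws" using assms(1) vs by (simp add: ws last_piece_def order_type_def)
  then have "piece_chain (last_piece \<sigma>) ws \<longleftrightarrow> b < t \<and> b < c \<and> piece_chain (last_piece \<sigma>) ?tl"
    by (simp add: ws)
  also have "\<dots> \<longleftrightarrow> ?R ws 0 \<and> (\<forall>j<Suc n. ?R ?tl j)"
  proof -
    \<comment> \<open>The next piece, of whichever kind, forces \<open>c < u\<close>. This supplies
      the third inequality of the current piece and excludes \<open>\<sigma>\<close> for it.\<close>
    have cu: "c < u" if "\<forall>j<Suc n. ?R ?tl j"
    proof -
      have "?R ?tl 0" using that by blast
      then show ?thesis using \<sigma>[of c u] by (auto simp: numeral_eq_Suc)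
    qed
    have r0: "?R ws 0 \<longleftrightarrow> b < t \<and> b < c \<and> c < u \<or> order_type \<sigma> [b, t, c, u]"
      by (simp add: ws numeral_eq_Suc)
    have "\<not> order_type \<sigma> [b, t, c, u]" if "c < u" using \<sigma>[of b t c u] that by auto
    then show ?thesis unfolding IH r0 using cu by blast
  qed
  also have "\<dots> \<longleftrightarrow> (\<forall>j<Suc (Suc n). ?R ws j)"
    unfolding All_less_Suc2[of "Suc n"] shift ..
  finally show ?case .
qed

section \<open>Encoding of puzzles as lists\<close>

text \<open>Row 0 is the upper row, so column \<open>j\<close> has its lower entry at position
  \<open>2 * j\<close> and its upper entry at \<open>2 * j + 1\<close>.\<close>

definition puzzle_of_list :: "nat \<Rightarrow> nat list \<Rightarrow> nat mat" where
  "puzzle_of_list n ws = mat 2 (n + 1) (\<lambda>(i, j). ws ! (2 * j + 1 - i))"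

lemma flat_index_inverse:
  fixes i j :: nat
  assumes "i < 2"
  shows "1 - (2 * j + 1 - i) mod 2 = i \<and> (2 * j + 1 - i) div 2 = j"
  using assms by presburger

lemma bij_betw_flat_index:
  "bij_betw (\<lambda>(i, j). 2 * j + 1 - i) ({0..<2} \<times> {0..<n + 1}) {..<2 * n + 2 :: nat}"
    (is "bij_betw ?f ?I ?K")
proof (rule bij_betw_byWitness[where f' = "\<lambda>k. (1 - k mod 2, k div 2)"])
  show "\<forall>ij\<in>?I. (1 - ?f ij mod 2, ?f ij div 2) = ij" using flat_index_inverse by simp
  have "2 * (k div 2) + 1 - (1 - k mod 2) = k" for k :: nat by presburger
  then show "\<forall>k\<in>?K. ?f (1 - k mod 2, k div 2) = k" by simp
  have "2 * j + 1 - i < 2 * n + 2" if "j < n + 1" for i j using that by linarith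
  then show "?f ` ?I \<subseteq> ?K" by auto
  have "1 - k mod 2 < 2" "k div 2 < n + 1" if "k < 2 * n + 2" for k
    using that by (simp_all add: less_mult_imp_div_less)
  then show "(\<lambda>k. (1 - k mod 2, k div 2)) ` ?K \<subseteq> ?I" by auto
qed

lemma standard_puzzle_of_list_iff:
  assumes "length ws = 2 * n + 2"
  shows "standard_puzzle n (puzzle_of_list n ws) \<longleftrightarrow> distinct ws \<and> set ws = {1..2 * n + 2}"
proof -
  let ?I = "{0..<2::nat} \<times> {0..<n + 1}"
  have "bij_betw (\<lambda>ij. puzzle_of_list n ws $$ ij) ?I {1..2 * n + 2} \<longleftrightarrow>
      bij_betw ((!) ws \<circ> (\<lambda>(i, j). 2 * j + 1 - i)) ?I {1..2 * n + 2}"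
    by (rule bij_betw_cong) (auto simp: puzzle_of_list_def)
  also have "\<dots> \<longleftrightarrow> bij_betw ((!) ws) {..<2 * n + 2} {1..2 * n + 2}"
    by (rule bij_betw_comp_iff[OF bij_betw_flat_index, symmetric])
  also have "\<dots> \<longleftrightarrow> distinct ws \<and> set ws = {1..2 * n + 2}"
  proof -
    have "set ws = (!) ws ` {..<2 * n + 2}" using assms by (auto simp: set_conv_nth)
    then show ?thesis using assms by (simp add: bij_betw_def distinct_conv_nth inj_on_def) blast
  qed
  finally show ?thesis
    by (simp add: standard_puzzle_def distinct_entries_def puzzle_of_list_def)
qed

lemma puzzle_of_list_inj:
  assumes "length ws = 2 * n + 2" "length ws' = 2 * n + 2"
    and "puzzle_of_list n ws = puzzle_of_list n ws'"
  shows "ws = ws'"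
proof (rule nth_equalityI)
  fix k assume "k < length ws"
  then have "k div 2 < n + 1" using assms(1) by simp
  moreover have "puzzle_of_list n ws $$ (1 - k mod 2, k div 2) = puzzle_of_list n ws' $$ (1 - k mod 2, k div 2)"
    using assms(3) by simp
  moreover have "2 * (k div 2) + 1 - (1 - k mod 2) = k" by presburger
  ultimately show "ws ! k = ws' ! k" by (simp add: puzzle_of_list_def)
qed (use assms in simp)

lemma puzzle_of_list_surj:
  assumes "M \<in> carrier_mat 2 (n + 1)"
  obtains ws where "length ws = 2 * n + 2" "M = puzzle_of_list n ws"
proof
  define ws where "ws = map (\<lambda>k. M $$ (1 - k mod 2, k div 2)) [0..<2 * n + 2]"
  show "length ws = 2 * n + 2" by (simp add: ws_def)
  have ws_nth: "ws ! k = M $$ (1 - k mod 2, k div 2)" if "k < 2 * n + 2" for k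
    using that unfolding ws_def by (simp del: upt_Suc)
  show "M = puzzle_of_list n ws"
  proof (rule eq_matI)
    fix i j assume "i < dim_row (puzzle_of_list n ws)" "j < dim_col (puzzle_of_list n ws)"
    then have ij: "i < 2" "j < n + 1" by (simp_all add: puzzle_of_list_def)
    then have "2 * j + 1 - i < 2 * n + 2" by linarith
    then have "ws ! (2 * j + 1 - i) = M $$ (i, j)"
      using flat_index_inverse[OF ij(1), of j] by (simp only: ws_nth)
    then show "M $$ (i, j) = puzzle_of_list n ws $$ (i, j)"
      using ij by (simp add: puzzle_of_list_def)
  qed (use assms in \<open>simp_all add: puzzle_of_list_def\<close>)
qed

lemma is_support_puzzle_of_list:
  "is_support P (puzzle_of_list n ws) \<longleftrightarrow>
    (\<forall>j<n. reduction (mat_of_rows_list 2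
      [[ws ! (2*j+1), ws ! (2*j+3)], [ws ! (2*j), ws ! (2*j+2)]]) \<in> P)"
proof -
  let ?M = "puzzle_of_list n ws"
  have "mat 2 2 (\<lambda>(i, k). ?M $$ (i, j + k)) = mat_of_rows_list 2
      [[ws ! (2*j+1), ws ! (2*j+3)], [ws ! (2*j), ws ! (2*j+2)]]" (is "?L = ?R")
    if "j < n" for j
  proof (rule eq_matI)
    fix i k assume "i < dim_row ?R" "k < dim_col ?R"
    then have "i = 0 \<or> i = 1" "k = 0 \<or> k = 1" by (auto simp: mat_of_rows_list_def)
    then show "?L $$ (i, k) = ?R $$ (i, k)"
      using that by (elim disjE) (simp_all add: puzzle_of_list_def mat_of_rows_list_def numeral_3_eq_3)
  qed (simp_all add: mat_of_rows_list_def)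
  moreover have "pieces ?M = (\<lambda>j. mat 2 2 (\<lambda>(i, k). ?M $$ (i, j + k))) ` {..<n}"
    by (auto simp: pieces_def puzzle_of_list_def)
  ultimately show ?thesis by (auto simp: is_support_def)
qed

section \<open>Transfer of the counts to puzzles\<close>

text \<open>\<open>puzzle_of_list\<close> maps the chains bijectively onto the supported puzzles.
  The index \<open>Suc n\<close> guarantees at least one piece, that is, four entries.\<close>

lemma s_count_eq_card_chain_lists:
  assumes "length \<sigma> = 4"
    and \<sigma>: "\<And>b t c u. order_type \<sigma> [b, t, c, u] \<Longrightarrow> b < t \<and> u < c"
    and B: "\<And>b t c u. distinct [t, u, b, c] \<Longrightarrow>
      reduction (mat_of_rows_list 2 [[t, u], [b, c]]) = B \<longleftrightarrow> order_type \<sigma> [b, t, c, u]"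
  shows "s_count (Suc n) ({A1, A2, A3} \<union> {B}) = card (chain_lists (last_piece \<sigma>) {1..2 * n + 4})"
proof -
  let ?P = "{A1, A2, A3} \<union> {B}" and ?X = "{1..2 * n + 4}" and ?p = "puzzle_of_list (Suc n)"
  have supp: "is_support ?P (?p ws) \<longleftrightarrow> piece_chain (last_piece \<sigma>) ws"
    if ws: "distinct ws" "length ws = 2 * n + 4" for ws
  proof -
    let ?R = "\<lambda>j. ws ! (2*j) < ws ! (2*j+1) \<and> ws ! (2*j) < ws ! (2*j+2) \<and> ws ! (2*j+2) < ws ! (2*j+3)
      \<or> order_type \<sigma> [ws ! (2*j), ws ! (2*j+1), ws ! (2*j+2), ws ! (2*j+3)]"
    have "reduction (mat_of_rows_list 2 [[ws ! (2*j+1), ws ! (2*j+3)], [ws ! (2*j), ws ! (2*j+2)]]) \<in> ?P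
      \<longleftrightarrow> ?R j" if "j < Suc n" for j
    proof -
      have "distinct [ws ! (2*j+1), ws ! (2*j+3), ws ! (2*j), ws ! (2*j+2)]"
        using ws that by (simp add: nth_eq_iff_index_eq)
      then show ?thesis using reduction_in_P_iff B by (metis Un_iff singleton_iff)
    qed
    then have "is_support ?P (?p ws) \<longleftrightarrow> (\<forall>j<Suc n. ?R j)"
      unfolding is_support_puzzle_of_list by (rule all_cong)
    also have "\<dots> \<longleftrightarrow> piece_chain (last_piece \<sigma>) ws"
      by (rule piece_chain_last_piece_iff[OF assms(1) _ ws(2), symmetric]) (rule \<sigma>)
    finally show ?thesis .
  qed
  have "supported_puzzles (Suc n) ?P = ?p ` chain_lists (last_piece \<sigma>) ?X"
  proof (intro equalityI subsetI)
    fix M assume "M \<in> supported_puzzles (Suc n) ?P"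
    then have M: "standard_puzzle (Suc n) M" "is_support ?P M" by (simp_all add: supported_puzzles_def)
    then have "M \<in> carrier_mat 2 (Suc n + 1)" by (simp add: standard_puzzle_def)
    then obtain ws where ws: "length ws = 2 * Suc n + 2" "M = ?p ws" by (rule puzzle_of_list_surj)
    then have "distinct ws" "set ws = ?X"
      using M(1) standard_puzzle_of_list_iff[OF ws(1)] by simp_all
    then have "ws \<in> chain_lists (last_piece \<sigma>) ?X"
      using supp[of ws] M(2) ws by (simp add: chain_lists_def)
    then show "M \<in> ?p ` chain_lists (last_piece \<sigma>) ?X" using ws(2) by blast
  next
    fix M assume "M \<in> ?p ` chain_lists (last_piece \<sigma>) ?X"
    then obtain ws where ws: "M = ?p ws" "distinct ws" "set ws = ?X" "piece_chain (last_piece \<sigma>) ws"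
      by (auto simp: chain_lists_def)
    have len: "length ws = 2 * n + 4" using distinct_card[OF ws(2)] ws(3) by simp
    then have "standard_puzzle (Suc n) M"
      unfolding ws(1) using standard_puzzle_of_list_iff[of ws "Suc n"] ws(2,3) by simp
    then show "M \<in> supported_puzzles (Suc n) ?P"
      using supp[OF ws(2) len] ws by (simp add: supported_puzzles_def)
  qed
  moreover have "inj_on ?p (chain_lists (last_piece \<sigma>) ?X)"
  proof (rule inj_onI)
    have len: "length ws = 2 * Suc n + 2" if "ws \<in> chain_lists (last_piece \<sigma>) ?X" for ws
      using that distinct_card[of ws] by (simp add: chain_lists_def)
    fix ws ws' assume "ws \<in> chain_lists (last_piece \<sigma>) ?X" "ws' \<in> chain_lists (last_piece \<sigma>) ?X" "?p ws = ?p ws'"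
    then show "ws = ws'" using len puzzle_of_list_inj by blast
  qed
  ultimately show ?thesis by (simp add: s_count_def card_image)
qed

theorem theorem4p2:
  fixes n :: nat
  assumes "n \<ge> 1"
  defines "P \<equiv> {A1, A2, A3}"
  shows "real (s_count n (P \<union> {B1})) = 4 / 3 * real (double_fact (2 * n + 1))
       \<and> real (s_count n (P \<union> {B2})) = 4 / 3 * real (double_fact (2 * n + 1))
       \<and> real (s_count n (P \<union> {B3})) = 4 / 3 * real (double_fact (2 * n + 1))
       \<and> s_count n (P \<union> {B4}) = 2 ^ n * fact (n + 1)
       \<and> s_count n (P \<union> {B5}) = 2 ^ n * fact (n + 1)
       \<and> int (s_count n (P \<union> {B6})) =
           (int n + 3) * int (double_fact (2 * n + 1)) - int (double_fact (2 * n + 2))"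
proof -
  obtain m where n: "n = Suc m" using assms(1) by (cases n) auto
  let ?X = "{1..2 * m + 4}"
  have X: "finite ?X" "card ?X = 2 * m + 4" by simp_all
  note red = reduction_eq_iff_order_type
  have count: "s_count n (P \<union> {B1}) = card (chain_lists (last_piece [0, 3, 2, 1]) ?X)"
    "s_count n (P \<union> {B2}) = card (chain_lists (last_piece [0, 3, 1, 2]) ?X)"
    "s_count n (P \<union> {B3}) = card (chain_lists (last_piece [0, 1, 3, 2]) ?X)"
    "s_count n (P \<union> {B4}) = card (chain_lists (last_piece [3, 0, 1, 2]) ?X)"
    "s_count n (P \<union> {B5}) = card (chain_lists (last_piece [3, 0, 2, 1]) ?X)"
    "s_count n (P \<union> {B6}) = card (chain_lists (last_piece [3, 2, 0, 1]) ?X)"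
    unfolding n P_def
    by (rule s_count_eq_card_chain_lists[OF _ _ red(1)] s_count_eq_card_chain_lists[OF _ _ red(2)]
        s_count_eq_card_chain_lists[OF _ _ red(3)] s_count_eq_card_chain_lists[OF _ _ red(4)]
        s_count_eq_card_chain_lists[OF _ _ red(5)] s_count_eq_card_chain_lists[OF _ _ red(6)];
      simp add: order_type_def)+
  have idx: "2 * n + 1 = 2 * m + 3" "2 * n + 2 = 2 * m + 4" by (simp_all add: n)
  \<comment> \<open>\<open>B1\<close>, \<open>B2\<close>, \<open>B3\<close> have their least entry
    at the lower left, position 0.\<close>
  have first: "real (card (chain_lists (last_piece (0 # \<sigma>)) ?X)) = 4 / 3 * real (double_fact (2 * n + 1))"
    if "set \<sigma> = {1, 2, 3}" "length \<sigma> = 3" "\<And>ws. order_type (0 # \<sigma>) ws \<Longrightarrow> ws ! 3 < ws ! 2" for \<sigma>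
  proof -
    have "real (3 * card (chain_lists (last_piece (0 # \<sigma>)) ?X)) = real (4 * double_fact (2 * n + 1))"
      unfolding idx using card_last_piece_min_first[OF X that] by (simp only:)
    then show ?thesis unfolding of_nat_mult by simp
  qed
  \<comment> \<open>\<open>B4\<close>, \<open>B5\<close> have 1 at the upper right and 2 at the
    lower left.\<close>
  have last: "card (chain_lists (last_piece (3 # 0 # \<sigma>)) ?X) = 2 ^ n * fact (n + 1)"
    if "set \<sigma> = {1, 2}" "length \<sigma> = 2" "\<And>ws. order_type (3 # 0 # \<sigma>) ws \<Longrightarrow> ws ! 3 < ws ! 2" for \<sigma>
    using card_last_piece_min_last[OF X that] by (simp add: n)
  \<comment> \<open>\<open>B6\<close> has 1 and 2 both in its right column.\<close>
  have both: "int (card (chain_lists (last_piece [3, 2, 0, 1]) ?X)) =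
      (int n + 3) * int (double_fact (2 * n + 1)) - int (double_fact (2 * n + 2))"
  proof -
    have "int (card (chain_lists (last_piece [3, 2, 0, 1]) ?X)) + int (double_fact (2 * m + 4))
        = int (m + 4) * int (double_fact (2 * m + 3))"
      using card_last_piece_both_last[OF X] by (metis of_nat_add of_nat_mult)
    moreover have "int (m + 4) = int n + 3" by (simp add: n)
    ultimately show ?thesis unfolding idx by (simp only: eq_diff_eq)
  qed
  show ?thesis unfolding count
    by (intro conjI first last both) (auto simp: order_type_def)
qed

end
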